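(* Let $q\ge 1$ and let $\mathbf{n}=(n_1,\dots,n_d)$ be a vector of positive integers. The number of Lyndon words of size $\mathbf{n}$ over an alphabet of size $q$ is $$|\mathcal{L}_q^{\mathbf{n}}| = \sum_{f_1 \mid n_1} \mu\!\left(\frac{n_1}{f_1}\right) \sum_{f_2 \mid n_2}\mu\!\left(\frac{n_2}{f_2}\right)\cdots \sum_{f_d \mid n_d} \mu\!\left(\frac{n_d}{f_d}\right) |\mathcal{N}_q^{(f_1,f_2,\dots, f_d)}|,$$ where $\mu$ is the Möbius function.
   Context: Let $\Sigma=\{1,\dots,q\}$. A word of size $\mathbf{n}=(n_1,\dots,n_d)$ is an array $w=(w_p)$ of symbols of $\Sigma$ indexed by positions $p=(p_1,\dots,p_d)$ with $1\le p_i\le n_i$; $\Sigma^{\mathbf{n}}$ is the set of all such words. The $i$-th coordinate of a position is read modulo $n_i$. The group of translations is $Z_{\mathbf{n}}=Z_{n_1}\times\dots\times Z_{n_d}$; for $g\in Z_{\mathbf{n}}$, $\langle w\rangle_g$ is the word with $(\langle w\rangle_g)_p=w_{p+g}$. A necklace of size $\mathbf{n}$ is an orbit of words of $\Sigma^{\mathbf{n}}$ under translation; $\mathcal{N}_q^{\mathbf{n}}$ is the set of necklaces of size $\mathbf{n}$. A word $w$ of size $\mathbf{n}$ is aperiodic if there is no word $v$ of size $\mathbf{m}\ne\mathbf{n}$, with $m_i$ dividing $n_i$ for every $i$, such that $w_{(j_1,\dots,j_d)}=v_{(j_1 \bmod m_1,\dots,j_d \bmod m_d)}$ for every position $j$ of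 $w$. A necklace is aperiodic if every word in it is aperiodic; an aperiodic necklace is called a Lyndon word, and $\mathcal{L}_q^{\mathbf{n}}$ is the set of Lyndon words of size $\mathbf{n}$. The paper tacitly orders dimensions of a size vector so that $n_1\le n_2\le\dots\le n_d$; $\mathcal{N}_q^{(f_1,\dots,f_d)}$ is defined for every vector of positive integers. *)

theory Defs
  imports "HOL-Algebra.Algebra" "HOL-Computational_Algebra.Computational_Algebra"
begin

text \<open>Size vectors $(n_1,\dots,n_d)$ are lists of (positive) natural numbers. Positions are
  lists of integers, 1-based; \<open>wrap ns\<close> reads the $i$-th coordinate modulo $n_i$, choosing
  the representative in $\{1,\dots,n_i\}$.\<close>

definition positions :: "nat list \<Rightarrow> int list set" where
  "positions ns = {p. list_all2 (\<lambda>x n. 1 \<le> x \<and> x \<le> int n) p ns}"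

definition wrap :: "nat list \<Rightarrow> int list \<Rightarrow> int list" where
  "wrap ns p = map2 (\<lambda>n x. (x - 1) mod int n + 1) ns p"

definition words :: "nat \<Rightarrow> nat list \<Rightarrow> (int list \<Rightarrow> nat) set" where
  "words q ns = (positions ns \<rightarrow>\<^sub>E {1..q})"

definition translation_group :: "nat list \<Rightarrow> int list monoid" where
  "translation_group ns = DirProd_list (map integer_mod_group ns)"

definition translate :: "nat list \<Rightarrow> int list \<Rightarrow> (int list \<Rightarrow> nat) \<Rightarrow> (int list \<Rightarrow> nat)" where
  "translate ns g w = (\<lambda>p\<in>positions ns. w (wrap ns (map2 (+) p g)))"

definition necklaces :: "nat \<Rightarrow> nat list \<Rightarrow> (int list \<Rightarrow> nat) set set" where
  "necklaces q ns = orbits (translation_group ns) (words q ns) (translate ns)"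

definition aperiodic_word :: "nat \<Rightarrow> nat list \<Rightarrow> (int list \<Rightarrow> nat) \<Rightarrow> bool" where
  "aperiodic_word q ns w \<longleftrightarrow>
     \<not> (\<exists>ms v. ms \<noteq> ns \<and> list_all2 (dvd) ms ns \<and> v \<in> words q ms \<and>
              (\<forall>j\<in>positions ns. w j = v (wrap ms j)))"

definition lyndon_words :: "nat \<Rightarrow> nat list \<Rightarrow> (int list \<Rightarrow> nat) set set" where
  "lyndon_words q ns = {N \<in> necklaces q ns. \<forall>w\<in>N. aperiodic_word q ns w}"

definition moebius_mu :: "nat \<Rightarrow> int" where
  "moebius_mu n = (if squarefree n then (- 1) ^ card (prime_factors n) else 0)"

text \<open>\<open>moebius_sum [n\<^sub>1, \<dots>, n\<^sub>d] F\<close> is the nested sum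
  $\sum_{f_1 \mid n_1} \mu(n_1/f_1) \cdots \sum_{f_d \mid n_d} \mu(n_d/f_d)\, F(f_1,\dots,f_d)$.\<close>

fun moebius_sum :: "nat list \<Rightarrow> (nat list \<Rightarrow> int) \<Rightarrow> int" where
  "moebius_sum [] F = F []"
| "moebius_sum (n # ns) F =
     (\<Sum>f | f dvd n. moebius_mu (n div f) * moebius_sum ns (\<lambda>fs. F (f # fs)))"

end

theory Submission
  imports Defs
begin

text \<open>
  Call a size \<open>ms\<close> a divisor of \<open>ns\<close> if each entry of \<open>ms\<close> divides the corresponding entry of
  \<open>ns\<close>. Every word of size \<open>ns\<close> is the periodic extension of exactly one aperiodic word, its root,
  whose size is a divisor of \<open>ns\<close>. A root exists because a proper period has a smaller sum of
  entries (\<open>aperiodic_root_exists\<close>). It is unique because two period vectors of a word have their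
  coordinatewise gcd as a period as well (\<open>gcd_period\<close>), so that the sizes of two roots both equal
  their gcd.

  Translations commute with periodic extension. Hence the roots of the words in a necklace have a
  common size and form a Lyndon word of that size, and every Lyndon word whose size divides \<open>ns\<close>
  arises from exactly one necklace (\<open>bij_betw_lyndon_words_necklaces\<close>). So the necklaces of size
  \<open>ns\<close> are counted by summing the numbers of Lyndon words over all divisors of \<open>ns\<close>
  (\<open>card_necklaces\<close>). This holds for all divisors of \<open>ns\<close> in place of \<open>ns\<close>, and Moebius inversion
  in each coordinate (\<open>moebius_sum_inversion\<close>) solves for the number of Lyndon words.
\<close>

section \<open>Moebius inversion along the divisors of a size vector\<close>

abbreviation positive :: "nat list \<Rightarrow> bool" where
  "positive ns \<equiv> \<forall>n\<in>set ns. n > 0"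

lemma bij_betw_prime_factors_squarefree_divisors:
  fixes n :: nat
  assumes "n > 0"
  shows "bij_betw prime_factors {d. d dvd n \<and> squarefree d} (Pow (prime_factors n))"
proof (rule bij_betw_byWitness[where f' = "\<lambda>P. \<Prod>P"])
  show "\<forall>d\<in>{d. d dvd n \<and> squarefree d}. \<Prod>(prime_factors d) = d"
  proof safe
    fix d assume d: "d dvd n" "squarefree d"
    then have "d \<noteq> 0" using assms by auto
    then have "(\<Prod>p\<in>prime_factors d. p ^ multiplicity p d) = d"
      by (simp add: prod_prime_factors)
    moreover have "(\<Prod>p\<in>prime_factors d. p ^ multiplicity p d) = \<Prod>(prime_factors d)"
      using d(2) \<open>d \<noteq> 0\<close> by (intro prod.cong) (auto simp: squarefree_factorial_semiring')
    ultimately show "\<Prod>(prime_factors d) = d" by simp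
  qed
  have *: "prime_factors (\<Prod>P) = P \<and> squarefree (\<Prod>P) \<and> \<Prod>P dvd n"
    if P: "P \<subseteq> prime_factors n" for P
  proof (intro conjI)
    have fin: "finite P" using P by (rule finite_subset) simp
    have pr: "Factorial_Ring.prime p" if "p \<in> P" for p using that P by auto
    have "0 \<notin> P" using pr not_prime_0 by blast
    then show "prime_factors (\<Prod>P) = P"
      using fin pr by (auto simp: prime_factors_prod prime_prime_factors)
    show "squarefree (\<Prod>P)"
      using pr by (intro squarefree_prod_coprime) (auto intro: primes_coprime squarefree_prime)
    have "\<Prod>P dvd \<Prod>(prime_factors n)"
      using P by (intro prod_dvd_prod_subset) auto
    also have "\<dots> dvd (\<Prod>p\<in>prime_factors n. p ^ multiplicity p n)"
      using assms by (intro prod_dvd_prod dvd_power) (auto simp: prime_factors_multiplicity)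
    also have "\<dots> = n" using assms by (simp add: prod_prime_factors)
    finally show "\<Prod>P dvd n" .
  qed
  then show "\<forall>P\<in>Pow (prime_factors n). prime_factors (\<Prod>P) = P"
    and "(\<lambda>P. \<Prod>P) ` Pow (prime_factors n) \<subseteq> {d. d dvd n \<and> squarefree d}"
    by auto
  show "prime_factors ` {d. d dvd n \<and> squarefree d} \<subseteq> Pow (prime_factors n)"
    using assms by (auto dest: dvd_prime_factors[rotated])
qed

text \<open>Only squarefree divisors contribute, and these are the subproducts of the primes of \<open>n\<close>,
  so the sum is the expansion of a product of factors \<open>1 - 1\<close>, one for each of these primes.\<close>

lemma sum_moebius_mu_divisors:
  assumes "n > 0"
  shows "(\<Sum>d | d dvd n. moebius_mu d) = (if n = 1 then 1 else 0)"
proof -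
  have "(\<Sum>d | d dvd n. moebius_mu d) = (\<Sum>d | d dvd n \<and> squarefree d. (-1) ^ card (prime_factors d))"
    using assms by (intro sum.mono_neutral_cong_right) (auto simp: moebius_mu_def)
  also have "\<dots> = (\<Sum>P\<in>Pow (prime_factors n). (-1) ^ card P)"
    by (rule sum.reindex_bij_betw[OF bij_betw_prime_factors_squarefree_divisors[OF assms]])
  also have "\<dots> = (\<Prod>p\<in>prime_factors n. 1 - 1)"
    by (subst prod_diff_conv_sum) auto
  also have "\<dots> = (if n = 1 then 1 else 0)"
    using assms by (auto simp: power_0_left prime_factorization_empty_iff)
  finally show ?thesis .
qed

lemma moebius_inversion:
  fixes g :: "nat \<Rightarrow> int"
  assumes "n > 0"
  shows "(\<Sum>f | f dvd n. moebius_mu (n div f) * (\<Sum>e | e dvd f. g e)) = g n"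
proof -
  have fin: "finite {d. d dvd n}" using assms by simp
  have "(\<Sum>f | f dvd n. moebius_mu (n div f) * (\<Sum>e | e dvd f. g e)) =
    (\<Sum>f\<in>{f. f dvd n}. \<Sum>e\<in>{e. e \<in> {e. e dvd n} \<and> e dvd f}. moebius_mu (n div f) * g e)"
    unfolding sum_distrib_left by (intro sum.cong) (auto intro: dvd_trans)
  also have "\<dots> = (\<Sum>e\<in>{e. e dvd n}. \<Sum>f\<in>{f. f \<in> {f. f dvd n} \<and> e dvd f}. moebius_mu (n div f) * g e)"
    by (rule sum.swap_restrict[OF fin fin])
  also have "\<dots> = (\<Sum>e\<in>{e. e dvd n}. if e = n then g e else 0)"
  proof (rule sum.cong[OF refl])
    fix e assume "e \<in> {e. e dvd n}"
    then obtain k where k: "n = e * k" by (auto elim: dvdE)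
    with assms have pos: "e > 0" "k > 0" by auto
    \<comment> \<open>The multiples of \<open>e\<close> that divide \<open>n = e * k\<close> are the quotients of \<open>n\<close> by divisors of \<open>k\<close>.\<close>
    have "(\<Sum>f\<in>{f. f \<in> {f. f dvd n} \<and> e dvd f}. moebius_mu (n div f) * g e) =
      (\<Sum>c | c dvd k. moebius_mu c * g e)"
      using assms pos k
      by (intro sum.reindex_bij_witness[where i = "\<lambda>c. n div c" and j = "\<lambda>f. n div f"])
         (auto elim!: dvdE)
    also have "\<dots> = (if e = n then g e else 0)"
      using sum_moebius_mu_divisors[OF pos(2)] pos k by (simp flip: sum_distrib_right)
    finally show "(\<Sum>f\<in>{f. f \<in> {f. f dvd n} \<and> e dvd f}. moebius_mu (n div f) * g e) =
      (if e = n then g e else 0)" .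
  qed
  also have "\<dots> = g n" using fin by simp
  finally show ?thesis .
qed

lemma divisor_vectors_Cons:
  "{ls. list_all2 (dvd) ls (m # ms)} =
     (\<lambda>(l, ls). l # ls) ` ({l. l dvd m} \<times> {ls. list_all2 (dvd) ls ms})"
  by (auto simp: list_all2_Cons2)

lemma finite_divisor_vectors:
  fixes ns :: "nat list"
  assumes "positive ns"
  shows "finite {ms. list_all2 (dvd) ms ns}"
  using assms by (induction ns) (auto simp: divisor_vectors_Cons)

lemma positive_divisor_vector:
  assumes "list_all2 (dvd) ms ns" "positive ns"
  shows "positive ms"
  using assms by (induction rule: list_all2_induct) (auto intro: dvd_pos_nat)

lemma sum_divisor_vectors_Cons:
  fixes G :: "nat list \<Rightarrow> int"
  shows "(\<Sum>ls | list_all2 (dvd) ls (m # ms). G ls) =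
    (\<Sum>ls | list_all2 (dvd) ls ms. \<Sum>l | l dvd m. G (l # ls))"
proof -
  have "(\<Sum>ls | list_all2 (dvd) ls (m # ms). G ls) =
    (\<Sum>(l, ls)\<in>{l. l dvd m} \<times> {ls. list_all2 (dvd) ls ms}. G (l # ls))"
    unfolding divisor_vectors_Cons
    by (subst sum.reindex) (auto simp: inj_on_def case_prod_unfold)
  also have "\<dots> = (\<Sum>l | l dvd m. \<Sum>ls | list_all2 (dvd) ls ms. G (l # ls))"
    by (simp add: sum.cartesian_product)
  also have "\<dots> = (\<Sum>ls | list_all2 (dvd) ls ms. \<Sum>l | l dvd m. G (l # ls))"
    by (rule sum.swap)
  finally show ?thesis .
qed

text \<open>The nested sum inverts one coordinate at a time: for a fixed first entry \<open>f\<close>, the inner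
  sums invert the other coordinates of the function obtained by summing \<open>G\<close> over the divisors
  of \<open>f\<close>, which leaves an inversion in \<open>f\<close>.\<close>

lemma moebius_sum_inversion:
  assumes "positive ns"
    and "\<And>ms. list_all2 (dvd) ms ns \<Longrightarrow> F ms = (\<Sum>ls | list_all2 (dvd) ls ms. G ls)"
  shows "moebius_sum ns F = G ns"
  using assms
proof (induction ns arbitrary: F G)
  case Nil
  then show ?case by simp
next
  case (Cons n ns)
  have "moebius_sum ns (\<lambda>fs. F (f # fs)) = (\<Sum>e | e dvd f. G (e # ns))" if "f dvd n" for f
    by (rule Cons.IH) (use Cons.prems that in \<open>auto simp: sum_divisor_vectors_Cons\<close>)
  then have "moebius_sum (n # ns) F =
      (\<Sum>f | f dvd n. moebius_mu (n div f) * (\<Sum>e | e dvd f. G (e # ns)))"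
    by simp
  also have "\<dots> = G (n # ns)"
    using Cons.prems(1) by (intro moebius_inversion) auto
  finally show ?case .
qed

section \<open>Positions and their residues\<close>

lemma in_positions_iff:
  "p \<in> positions ns \<longleftrightarrow>
     length p = length ns \<and> (\<forall>i<length ns. 1 \<le> p ! i \<and> p ! i \<le> int (ns ! i))"
  by (auto simp: positions_def list_all2_conv_all_nth)

lemma length_wrap [simp]: "length (wrap ns p) = min (length ns) (length p)"
  by (simp add: wrap_def)

lemma nth_wrap [simp]:
  "i < length ns \<Longrightarrow> i < length p \<Longrightarrow> wrap ns p ! i = (p ! i - 1) mod int (ns ! i) + 1"
  by (simp add: wrap_def)

lemma wrap_in_positions:
  assumes "positive ns" "length p = length ns"
  shows "wrap ns p \<in> positions ns"
proof -
  have "1 \<le> a mod int n + 1 \<and> a mod int n + 1 \<le> int n" if "n > 0" for a n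
  proof -
    have "0 < int n" using that by simp
    from pos_mod_bound[OF this, of a] pos_mod_sign[OF this, of a] show ?thesis by linarith
  qed
  then show ?thesis using assms by (simp add: in_positions_iff)
qed

lemma wrap_positions:
  assumes "p \<in> positions ns"
  shows "wrap ns p = p"
  using assms by (intro nth_equalityI) (auto simp: in_positions_iff mod_pos_pos_trivial)

lemma wrap_eq_iff:
  assumes "length p = length ms" "length r = length ms"
  shows "wrap ms p = wrap ms r \<longleftrightarrow> (\<forall>i<length ms. p ! i mod int (ms ! i) = r ! i mod int (ms ! i))"
proof -
  have "(a - 1) mod m = (b - 1) mod m \<longleftrightarrow> a mod m = b mod m" for a b m :: int
    by (simp add: mod_eq_dvd_iff)
  then show ?thesis using assms by (simp add: list_eq_iff_nth_eq)
qed

lemma wrap_nth_mod: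
  assumes "list_all2 (dvd) ms ns" "length p = length ns" "i < length ns"
  shows "wrap ns p ! i mod int (ms ! i) = p ! i mod int (ms ! i)"
proof -
  have "int (ms ! i) dvd int (ns ! i)"
    using assms by (simp add: list_all2_conv_all_nth)
  then have "((p ! i - 1) mod int (ns ! i) + 1) mod int (ms ! i) = (p ! i - 1 + 1) mod int (ms ! i)"
    by (metis mod_add_left_eq mod_mod_cancel)
  then show ?thesis using assms(2,3) by simp
qed

lemma dvd_vector_refl: "list_all2 (dvd) ns (ns :: nat list)"
  by (simp add: list_all2_refl)

lemma wrap_wrap:
  assumes "list_all2 (dvd) ms ns" "length p = length ns"
  shows "wrap ms (wrap ns p) = wrap ms p"
  using assms wrap_nth_mod[OF assms] by (subst wrap_eq_iff) (auto dest: list_all2_lengthD)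

lemma wrap_add_wrap:
  assumes "list_all2 (dvd) ms ns" "length p = length ns" "length g = length ns"
  shows "wrap ms (map2 (+) (wrap ns p) g) = wrap ms (map2 (+) p g)"
  using assms list_all2_lengthD[OF assms(1)]
  by (subst wrap_eq_iff) (auto intro: mod_add_cong simp: wrap_nth_mod simp del: nth_wrap)

lemma positions_mono:
  assumes "list_all2 (dvd) ms ns" "positive ns"
  shows "positions ms \<subseteq> positions ns"
proof -
  have "ms ! i \<le> ns ! i" if "i < length ns" for i
    using that assms by (auto simp: list_all2_conv_all_nth intro!: dvd_imp_le)
  then show ?thesis
    using assms(1) by (fastforce simp: in_positions_iff dest: list_all2_lengthD)
qed

lemma wrap_add_in_positions:
  assumes "positive ns" "p \<in> positions ns" "length g = length ns"
  shows "wrap ns (map2 (+) p g) \<in> positions ns"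
  using assms by (intro wrap_in_positions) (auto simp: in_positions_iff)

lemma wrap_divisor_in_positions:
  assumes "list_all2 (dvd) ms ns" "positive ns" "p \<in> positions ns"
  shows "wrap ms p \<in> positions ms"
  using assms positive_divisor_vector[OF assms(1,2)] list_all2_lengthD[OF assms(1)]
  by (intro wrap_in_positions) (auto simp: in_positions_iff)

lemma finite_positions: "finite (positions ns)"
proof (rule finite_subset)
  show "positions ns \<subseteq> {p. set p \<subseteq> {1..int (sum_list ns)} \<and> length p = length ns}"
    by (auto simp: in_positions_iff in_set_conv_nth)
       (metis elem_le_sum_list of_nat_le_iff order_trans)
  show "finite {p. set p \<subseteq> {1..int (sum_list ns)} \<and> length p = length ns}"
    by (rule finite_lists_length_eq) simp
qed

lemma finite_words: "finite (words q ns)"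
  unfolding words_def by (intro finite_PiE finite_positions) auto

section \<open>Translations\<close>

lemma translate_in_words:
  assumes "positive ns" "w \<in> words q ns" "length g = length ns"
  shows "translate ns g w \<in> words q ns"
  using assms by (simp add: words_def translate_def PiE_iff wrap_add_in_positions)

lemma translate_translate:
  assumes "positive ns" "length g = length ns" "length h = length ns"
  shows "translate ns g (translate ns h w) = translate ns (map2 (+) g h) w"
proof
  fix p
  have "wrap ns (map2 (+) (wrap ns (map2 (+) p g)) h) = wrap ns (map2 (+) p (map2 (+) g h))"
    if p: "p \<in> positions ns"
  proof -
    have "wrap ns (map2 (+) (wrap ns (map2 (+) p g)) h) = wrap ns (map2 (+) (map2 (+) p g) h)"
      using assms p by (intro wrap_add_wrap dvd_vector_refl) (auto simp: in_positions_iff)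
    also have "map2 (+) (map2 (+) p g) h = map2 (+) p (map2 (+) g h)"
      using assms p by (intro nth_equalityI) (auto simp: in_positions_iff)
    finally show ?thesis .
  qed
  then show "translate ns g (translate ns h w) p = translate ns (map2 (+) g h) w p"
    using assms by (simp add: translate_def wrap_add_in_positions)
qed

lemma translate_zero:
  assumes "w \<in> words q ns" "g = replicate (length ns) 0"
  shows "translate ns g w = w"
proof
  fix p
  have "map2 (+) p g = p" if "p \<in> positions ns"
    using that assms by (intro nth_equalityI) (auto simp: in_positions_iff)
  then show "translate ns g w p = w p"
    using assms(1) by (auto simp: translate_def wrap_positions words_def PiE_def extensional_def)
qed

lemma translate_uminus:
  assumes "positive ns" "w \<in> words q ns" "length g = length ns"
  shows "translate ns (map uminus g) (translate ns g w) = w"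
proof -
  have "map2 (+) (map uminus g) g = replicate (length ns) 0"
    using assms by (intro nth_equalityI) auto
  then show ?thesis using assms by (simp add: translate_translate translate_zero)
qed

text \<open>Translating by integer vectors that need not be reduced avoids all reductions modulo the
  size when orbits of words of different sizes are compared.\<close>

lemma orbit_translation_group:
  assumes "positive ns"
  shows "orbit (translation_group ns) (translate ns) w = {translate ns g w | g. length g = length ns}"
proof -
  have carrier: "g \<in> carrier (translation_group ns) \<longleftrightarrow>
    length g = length ns \<and> (\<forall>i<length ns. 0 \<le> g ! i \<and> g ! i < int (ns ! i))" for g
  proof
    assume "g \<in> carrier (translation_group ns)"
    note mem = DirProd_list_carrier_mem[OF this[unfolded translation_group_def]]
    have "0 \<le> g ! i \<and> g ! i < int (ns ! i)" if "i < length ns" for i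
    proof -
      have "ns ! i > 0" using assms that by simp
      then show ?thesis using mem(2)[of i] that by (simp add: carrier_integer_mod_group)
    qed
    then show "length g = length ns \<and> (\<forall>i<length ns. 0 \<le> g ! i \<and> g ! i < int (ns ! i))"
      using mem(1) by simp
  next
    assume "length g = length ns \<and> (\<forall>i<length ns. 0 \<le> g ! i \<and> g ! i < int (ns ! i))"
    then show "g \<in> carrier (translation_group ns)"
      unfolding translation_group_def
      using assms by (intro DirProd_list_carrier_memI) (auto simp: carrier_integer_mod_group)
  qed
  have "\<exists>h\<in>carrier (translation_group ns). translate ns h w = translate ns g w"
    if g: "length g = length ns" for g
  proof
    define h where "h = map2 (\<lambda>x n. x mod int n) g ns"
    show "h \<in> carrier (translation_group ns)"
      using g assms by (auto simp: h_def carrier)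
    have "wrap ns (map2 (+) p h) = wrap ns (map2 (+) p g)" if "p \<in> positions ns" for p
      using that g by (subst wrap_eq_iff) (auto simp: h_def in_positions_iff mod_add_right_eq)
    then show "translate ns h w = translate ns g w"
      by (auto simp: translate_def)
  qed
  moreover have "length g = length ns" if "g \<in> carrier (translation_group ns)" for g
    using that by (simp add: carrier)
  ultimately show ?thesis
    unfolding orbit_def by (intro equalityI subsetI; clarsimp) (blast, metis)
qed

lemma in_orbit_translation_group:
  assumes "positive ns" "w \<in> words q ns"
  shows "w \<in> orbit (translation_group ns) (translate ns) w"
  using assms translate_zero[OF assms(2) refl]
  by (auto simp: orbit_translation_group intro!: exI[of _ "replicate (length ns) 0"])

lemma necklace_subset_words:
  assumes "positive ns" "N \<in> necklaces q ns"
  shows "N \<subseteq> words q ns"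
  using assms by (auto simp: necklaces_def orbits_def orbit_translation_group translate_in_words)

section \<open>Periodic extensions\<close>

text \<open>An infinite periodic array, seen through a box of size \<open>ns\<close>; the vector \<open>ms\<close> of periods is
  meant to divide \<open>ns\<close>.\<close>

definition extension :: "nat list \<Rightarrow> nat list \<Rightarrow> (int list \<Rightarrow> nat) \<Rightarrow> (int list \<Rightarrow> nat)" where
  "extension ms ns v = (\<lambda>j\<in>positions ns. v (wrap ms j))"

lemma extension_in_words:
  assumes "list_all2 (dvd) ms ns" "positive ns" "v \<in> words q ms"
  shows "extension ms ns v \<in> words q ns"
  using assms by (simp add: words_def extension_def PiE_iff wrap_divisor_in_positions)

lemma extension_refl:
  assumes "w \<in> words q ns"
  shows "extension ns ns w = w"
  using assms by (auto simp: extension_def fun_eq_iff wrap_positions words_def PiE_def extensional_def)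

lemma extension_extension:
  assumes "list_all2 (dvd) ls ms" "list_all2 (dvd) ms ns" "positive ns"
  shows "extension ms ns (extension ls ms v) = extension ls ns v"
proof
  fix j
  have "wrap ls (wrap ms j) = wrap ls j" if "j \<in> positions ns"
    using that assms(1) list_all2_lengthD[OF assms(2)]
    by (intro wrap_wrap) (auto simp: in_positions_iff)
  then show "extension ms ns (extension ls ms v) j = extension ls ns v j"
    using assms(2,3) by (simp add: extension_def wrap_divisor_in_positions)
qed

lemma extension_apply:
  assumes "list_all2 (dvd) ms ns" "positive ns" "p \<in> positions ms"
  shows "extension ms ns v p = v p"
  using assms positions_mono[OF assms(1,2)] by (auto simp: extension_def wrap_positions)

lemma inj_on_extension:
  assumes "list_all2 (dvd) ms ns" "positive ns"
  shows "inj_on (extension ms ns) (words q ms)"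
proof (rule inj_onI)
  fix v v' assume v: "v \<in> words q ms" "v' \<in> words q ms"
    and eq: "extension ms ns v = extension ms ns v'"
  show "v = v'"
  proof (rule PiE_ext)
    show "v \<in> positions ms \<rightarrow>\<^sub>E {1..q}" "v' \<in> positions ms \<rightarrow>\<^sub>E {1..q}"
      using v by (simp_all add: words_def)
    show "v p = v' p" if "p \<in> positions ms" for p
      using extension_apply[OF assms that] eq by metis
  qed
qed

text \<open>The same integer vector \<open>g\<close> translates both words: reading modulo \<open>ns\<close> before reading modulo
  a divisor \<open>ms\<close> makes no difference.\<close>

lemma translate_extension:
  assumes "list_all2 (dvd) ms ns" "positive ns" "length g = length ns"
  shows "translate ns g (extension ms ns v) = extension ms ns (translate ms g v)"
proof
  fix p
  have len: "length ms = length ns" using assms(1) by (rule list_all2_lengthD)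
  have pos: "positive ms" using assms(1,2) by (rule positive_divisor_vector)
  show "translate ns g (extension ms ns v) p = extension ms ns (translate ms g v) p"
  proof (cases "p \<in> positions ns")
    case True
    then have p: "length p = length ns" by (simp add: in_positions_iff)
    then have "wrap ns (map2 (+) p g) \<in> positions ns" "wrap ms p \<in> positions ms"
      using assms len pos by (auto intro!: wrap_in_positions)
    then show ?thesis
      using True p assms len
      by (simp add: translate_def extension_def wrap_wrap wrap_add_wrap dvd_vector_refl)
  qed (simp add: translate_def extension_def)
qed

lemma orbit_extension:
  assumes "list_all2 (dvd) ms ns" "positive ns"
  shows "orbit (translation_group ns) (translate ns) (extension ms ns v) =
    extension ms ns ` orbit (translation_group ms) (translate ms) v"
proof -
  have "{translate ns g (extension ms ns v) | g. length g = length ns} =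
    {extension ms ns (translate ms g v) | g. length g = length ms}"
    using translate_extension[OF assms] list_all2_lengthD[OF assms(1)] by metis
  also have "\<dots> = extension ms ns ` {translate ms g v | g. length g = length ms}"
    by blast
  finally show ?thesis
    using assms positive_divisor_vector[OF assms] by (simp add: orbit_translation_group)
qed

section \<open>The aperiodic root of a word\<close>

lemma aperiodic_word_iff:
  assumes "w \<in> words q ns"
  shows "aperiodic_word q ns w \<longleftrightarrow>
    (\<forall>ms v. list_all2 (dvd) ms ns \<longrightarrow> v \<in> words q ms \<longrightarrow> w = extension ms ns v \<longrightarrow> ms = ns)"
proof -
  have "(\<forall>j\<in>positions ns. w j = v (wrap ms j)) \<longleftrightarrow> w = extension ms ns v" for ms v
    using assms by (auto simp: extension_def fun_eq_iff words_def PiE_def extensional_def)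
  then show ?thesis by (auto simp: aperiodic_word_def)
qed

text \<open>A periodic extension of a translate of \<open>w\<close> can be translated back to a periodic extension
  of \<open>w\<close>. This makes aperiodicity a property of the whole necklace.\<close>

lemma aperiodic_word_translate:
  assumes "positive ns" "w \<in> words q ns" "length g = length ns" "aperiodic_word q ns w"
  shows "aperiodic_word q ns (translate ns g w)"
proof -
  have "ms = ns" if ms: "list_all2 (dvd) ms ns" and v: "v \<in> words q ms"
    and eq: "translate ns g w = extension ms ns v" for ms v
  proof -
    have len: "length ms = length ns" using ms by (rule list_all2_lengthD)
    have "w = translate ns (map uminus g) (extension ms ns v)"
      using translate_uminus[OF assms(1-3)] eq by simp
    also have "\<dots> = extension ms ns (translate ms (map uminus g) v)"
      using assms ms by (intro translate_extension) auto
    finally have "w = extension ms ns (translate ms (map uminus g) v)" .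
    moreover have "translate ms (map uminus g) v \<in> words q ms"
      using assms(3) v len positive_divisor_vector[OF ms assms(1)]
      by (simp add: translate_in_words)
    ultimately show ?thesis
      using assms(2,4) ms by (simp add: aperiodic_word_iff)
  qed
  then show ?thesis
    using assms by (simp add: aperiodic_word_iff translate_in_words)
qed

lemma orbit_in_lyndon_words_iff:
  assumes "positive ns" "w \<in> words q ns"
  shows "orbit (translation_group ns) (translate ns) w \<in> lyndon_words q ns \<longleftrightarrow> aperiodic_word q ns w"
  using assms in_orbit_translation_group[OF assms] aperiodic_word_translate[OF assms]
  by (auto simp: lyndon_words_def necklaces_def orbits_def orbit_translation_group)

lemma sum_list_proper_divisor_vector:
  fixes ms ns :: "nat list"
  assumes "list_all2 (dvd) ms ns" "positive ns" "ms \<noteq> ns"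
  shows "sum_list ms < sum_list ns"
proof -
  have "sum_list ms \<le> sum_list ns \<and> (ms \<noteq> ns \<longrightarrow> sum_list ms < sum_list ns)"
    using assms(1,2)
  proof (induction rule: list_all2_induct)
    case (Cons m ms n ns)
    then have "m \<le> n" by (auto intro: dvd_imp_le)
    with Cons show ?case by auto
  qed simp
  with assms(3) show ?thesis by simp
qed

text \<open>A word with a proper period extends a word whose size has a smaller sum of entries, so taking
  proper periods repeatedly ends with an aperiodic word; extensions compose.\<close>

lemma aperiodic_root_exists:
  assumes "positive ns" "w \<in> words q ns"
  shows "\<exists>ms v. list_all2 (dvd) ms ns \<and> v \<in> words q ms \<and> aperiodic_word q ms v \<and>
    w = extension ms ns v"
  using assms
proof (induction "sum_list ns" arbitrary: ns w rule: less_induct)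
  case less
  show ?case
  proof (cases "aperiodic_word q ns w")
    case True
    then show ?thesis
      using less.prems dvd_vector_refl extension_refl[OF less.prems(2)] by metis
  next
    case False
    then obtain ms u where ms: "list_all2 (dvd) ms ns" "ms \<noteq> ns" and u: "u \<in> words q ms"
      and w: "w = extension ms ns u"
      using less.prems by (auto simp: aperiodic_word_iff)
    have "sum_list ms < sum_list ns"
      using sum_list_proper_divisor_vector[OF ms(1) less.prems(1) ms(2)] .
    from less.hyps[OF this positive_divisor_vector[OF ms(1) less.prems(1)] u]
    obtain ls v where ls: "list_all2 (dvd) ls ms" "v \<in> words q ls" "aperiodic_word q ls v"
      and u': "u = extension ls ms v" by blast
    have "list_all2 (dvd) ls ns"
      using list_all2_trans[OF _ ls(1) ms(1)] dvd_trans by blast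
    moreover have "w = extension ls ns v"
      using extension_extension[OF ls(1) ms(1) less.prems(1)] w u' by simp
    ultimately show ?thesis using ls by blast
  qed
qed

lemma crossing_residues_mod_gcd:
  fixes a b m n :: int
  assumes "a mod gcd m n = b mod gcd m n"
  shows "\<exists>c. c mod m = a mod m \<and> c mod n = b mod n"
proof -
  obtain t where t: "b - a = gcd m n * t"
    using assms by (metis dvdE mod_eq_dvd_iff)
  obtain u v where uv: "u * m + v * n = gcd m n" using bezout_int by blast
  have "a + m * (u * t) = b + n * (- v * t)"
    using t unfolding uv[symmetric] by (simp add: algebra_simps)
  then have "(a + m * (u * t)) mod m = a mod m \<and> (a + m * (u * t)) mod n = b mod n"
    by (metis mod_mult_self2)
  then show ?thesis by blast
qed

text \<open>If \<open>p\<close> and \<open>r\<close> agree modulo the coordinatewise gcd of two period vectors, then by the Chinese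
  remainder theorem some position agrees with \<open>p\<close> modulo the first vector and with \<open>r\<close> modulo the
  second. Moving from \<open>p\<close> to \<open>r\<close> through that position does not change the letter, so a word with
  both periods also has the gcd as a period.\<close>

lemma gcd_period:
  assumes ms: "list_all2 (dvd) ms ns" and ms': "list_all2 (dvd) ms' ns" and pos: "positive ns"
    and w: "w \<in> words q ns" "w = extension ms ns v" "w = extension ms' ns v'"
  defines "gs \<equiv> map2 gcd ms ms'"
  shows "\<exists>u\<in>words q gs. w = extension gs ns u"
proof
  have len: "length ms = length ns" "length ms' = length ns"
    using ms ms' by (auto dest: list_all2_lengthD)
  have gs: "list_all2 (dvd) gs ns"
    using ms ms' by (auto simp: gs_def list_all2_conv_all_nth intro: dvd_trans[OF gcd_dvd1])
  have posg: "positive gs" using gs pos by (rule positive_divisor_vector)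
  have eq: "w p = w r" if p: "p \<in> positions ns" and r: "r \<in> positions ns"
    and pr: "wrap gs p = wrap gs r" for p r
  proof -
    have lp: "length p = length ns" "length r = length ns"
      using p r by (auto simp: in_positions_iff)
    have "\<forall>i<length ns. \<exists>c. c mod int (ms ! i) = p ! i mod int (ms ! i) \<and>
        c mod int (ms' ! i) = r ! i mod int (ms' ! i)"
      using pr lp len by (subst (asm) wrap_eq_iff)
        (auto simp: gs_def intro!: crossing_residues_mod_gcd)
    then obtain c where c: "\<And>i. i < length ns \<Longrightarrow> c i mod int (ms ! i) = p ! i mod int (ms ! i) \<and>
        c i mod int (ms' ! i) = r ! i mod int (ms' ! i)"
      by metis
    define s where "s = map c [0..<length ns]"
    have ls: "length s = length ns" by (simp add: s_def)
    have s: "wrap ms s = wrap ms p" "wrap ms' s = wrap ms' r"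
      using c len lp by (auto simp: wrap_eq_iff s_def)
    have in_pos: "wrap ns s \<in> positions ns" using pos ls by (rule wrap_in_positions)
    have "w p = v (wrap ms p)" using w(2) p by (simp add: extension_def)
    also have "\<dots> = w (wrap ns s)"
      using w(2) in_pos s ls ms by (simp add: extension_def wrap_wrap)
    also have "\<dots> = v' (wrap ms' r)"
      using w(3) in_pos s ls ms' by (simp add: extension_def wrap_wrap)
    also have "\<dots> = w r" using w(3) r by (simp add: extension_def)
    finally show ?thesis .
  qed
  have sub: "positions gs \<subseteq> positions ns" using gs pos by (rule positions_mono)
  show "restrict w (positions gs) \<in> words q gs"
    using w(1) sub by (auto simp: words_def)
  show "w = extension gs ns (restrict w (positions gs))"
  proof
    fix p
    show "w p = extension gs ns (restrict w (positions gs)) p"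
    proof (cases "p \<in> positions ns")
      case True
      then have "wrap gs p \<in> positions gs"
        using posg gs by (auto simp: in_positions_iff[of p] dest: list_all2_lengthD intro!: wrap_in_positions)
      moreover from this have "w p = w (wrap gs p)"
        using True sub by (intro eq) (auto simp: wrap_positions)
      ultimately show ?thesis using True by (simp add: extension_def)
    next
      case False
      then show ?thesis using w(1) by (auto simp: extension_def words_def PiE_def extensional_def)
    qed
  qed
qed

text \<open>The gcd of the sizes of two roots of a word is a period of that word, hence of both roots,
  and by aperiodicity it equals both sizes.\<close>

lemma aperiodic_root_unique:
  assumes ms: "list_all2 (dvd) ms ns" and ms': "list_all2 (dvd) ms' ns" and pos: "positive ns"
    and v: "v \<in> words q ms" "aperiodic_word q ms v"
    and v': "v' \<in> words q ms'" "aperiodic_word q ms' v'"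
    and eq: "extension ms ns v = extension ms' ns v'"
  shows "ms = ms' \<and> v = v'"
proof -
  define gs where "gs = map2 gcd ms ms'"
  have len: "length ms = length ns" "length ms' = length ns"
    using ms ms' by (auto dest: list_all2_lengthD)
  have gs: "list_all2 (dvd) gs ms" "list_all2 (dvd) gs ms'"
    using len by (auto simp: gs_def list_all2_conv_all_nth)
  obtain u where u: "u \<in> words q gs" "extension ms ns v = extension gs ns u"
    using gcd_period[OF ms ms' pos extension_in_words[OF ms pos v(1)] refl eq]
    by (auto simp: gs_def)
  \<comment> \<open>An extension of an aperiodic word has no period that properly divides the size of that word.\<close>
  have root: "gs = ls" if ls: "list_all2 (dvd) ls ns" "list_all2 (dvd) gs ls" and x: "x \<in> words q ls"
    "aperiodic_word q ls x" "extension ls ns x = extension gs ns u" for ls x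
  proof -
    have posl: "positive ls" using ls(1) pos by (rule positive_divisor_vector)
    have "extension ls ns x = extension ls ns (extension gs ls u)"
      using extension_extension[OF ls(2,1) pos] x(3) by simp
    then have "x = extension gs ls u"
      using inj_onD[OF inj_on_extension[OF ls(1) pos]] x(1) extension_in_words[OF ls(2) posl u(1)]
      by blast
    then show ?thesis
      using aperiodic_word_iff[OF x(1)] x(2) ls(2) u(1) by blast
  qed
  have "gs = ms" using root[OF ms gs(1) v] u by simp
  moreover have "gs = ms'" using root[OF ms' gs(2) v'] u eq by simp
  ultimately show ?thesis
    using inj_onD[OF inj_on_extension[OF ms pos]] v(1) v'(1) eq by blast
qed

section \<open>Necklaces and Lyndon words\<close>

lemma finite_lyndon_words: "finite (lyndon_words q ns)"
proof -
  have "necklaces q ns = orbit (translation_group ns) (translate ns) ` words q ns"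
    by (auto simp: necklaces_def orbits_def)
  then show ?thesis by (simp add: lyndon_words_def finite_words)
qed

lemma lyndon_wordE:
  assumes "N \<in> lyndon_words q ns" "positive ns"
  obtains v where "v \<in> words q ns" "aperiodic_word q ns v" "v \<in> N"
    "N = orbit (translation_group ns) (translate ns) v"
proof -
  obtain v where v: "v \<in> words q ns" "N = orbit (translation_group ns) (translate ns) v"
    using assms(1) by (auto simp: lyndon_words_def necklaces_def orbits_def)
  with that assms show thesis
    using orbit_in_lyndon_words_iff in_orbit_translation_group by metis
qed

text \<open>Since translation commutes with periodic extension, extending a whole orbit gives an orbit. The
  map hits every necklace because each word has a root, and it is injective because a word common to
  two images would have two roots unless the sizes agree.\<close>

lemma bij_betw_lyndon_words_necklaces:
  assumes pos: "positive ns"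
  shows "bij_betw (\<lambda>(ms, N). extension ms ns ` N)
    (SIGMA ms:{ms. list_all2 (dvd) ms ns}. lyndon_words q ms) (necklaces q ns)"
  unfolding bij_betw_def
proof
  show "inj_on (\<lambda>(ms, N). extension ms ns ` N)
    (SIGMA ms:{ms. list_all2 (dvd) ms ns}. lyndon_words q ms)"
  proof (rule inj_onI, clarify)
    fix ms N ms' N'
    assume ms: "list_all2 (dvd) ms ns" and N: "N \<in> lyndon_words q ms"
      and ms': "list_all2 (dvd) ms' ns" and N': "N' \<in> lyndon_words q ms'"
      and eq: "extension ms ns ` N = extension ms' ns ` N'"
    have posm: "positive ms" "positive ms'"
      using positive_divisor_vector ms ms' pos by blast+
    obtain v where v: "v \<in> words q ms" "aperiodic_word q ms v" "v \<in> N"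
      using lyndon_wordE[OF N posm(1)] .
    obtain v' where v': "v' \<in> N'" "extension ms ns v = extension ms' ns v'"
      using eq v(3) by blast
    have sub: "N \<subseteq> words q ms" "N' \<subseteq> words q ms'"
      using necklace_subset_words posm N N' by (auto simp: lyndon_words_def)
    have "aperiodic_word q ms' v'" using v'(1) N' by (simp add: lyndon_words_def)
    then have "ms = ms'"
      using aperiodic_root_unique[OF ms ms' pos v(1,2) _ _ v'(2)] sub(2) v'(1) by blast
    then show "ms = ms' \<and> N = N'"
      using inj_on_image_eq_iff[OF inj_on_extension[OF ms pos] sub(1)] sub(2) eq by blast
  qed
  show "(\<lambda>(ms, N). extension ms ns ` N) `
    (SIGMA ms:{ms. list_all2 (dvd) ms ns}. lyndon_words q ms) = necklaces q ns"
  proof (intro equalityI subsetI)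
    fix M assume "M \<in> (\<lambda>(ms, N). extension ms ns ` N) `
      (SIGMA ms:{ms. list_all2 (dvd) ms ns}. lyndon_words q ms)"
    then obtain ms N where ms: "list_all2 (dvd) ms ns" and N: "N \<in> lyndon_words q ms"
      and M: "M = extension ms ns ` N" by auto
    obtain v where v: "v \<in> words q ms" "N = orbit (translation_group ms) (translate ms) v"
      using lyndon_wordE[OF N positive_divisor_vector[OF ms pos]] .
    have "M = orbit (translation_group ns) (translate ns) (extension ms ns v)"
      using M v orbit_extension[OF ms pos] by simp
    then show "M \<in> necklaces q ns"
      using extension_in_words[OF ms pos v(1)] by (auto simp: necklaces_def orbits_def)
  next
    fix M assume "M \<in> necklaces q ns"
    then obtain w where w: "w \<in> words q ns" "M = orbit (translation_group ns) (translate ns) w"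
      by (auto simp: necklaces_def orbits_def)
    obtain ms v where ms: "list_all2 (dvd) ms ns" and v: "v \<in> words q ms" "aperiodic_word q ms v"
      and wv: "w = extension ms ns v"
      using aperiodic_root_exists[OF pos w(1)] by blast
    let ?N = "orbit (translation_group ms) (translate ms) v"
    have "?N \<in> lyndon_words q ms"
      using orbit_in_lyndon_words_iff[OF positive_divisor_vector[OF ms pos] v(1)] v(2) by simp
    moreover have "M = extension ms ns ` ?N"
      using w wv orbit_extension[OF ms pos] by simp
    ultimately show "M \<in> (\<lambda>(ms, N). extension ms ns ` N) `
      (SIGMA ms:{ms. list_all2 (dvd) ms ns}. lyndon_words q ms)"
      using ms by force
  qed
qed

lemma card_necklaces:
  assumes "positive ns"
  shows "card (necklaces q ns) = (\<Sum>ms | list_all2 (dvd) ms ns. card (lyndon_words q ms))"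
proof -
  have "card (necklaces q ns) = card (SIGMA ms:{ms. list_all2 (dvd) ms ns}. lyndon_words q ms)"
    using bij_betw_same_card[OF bij_betw_lyndon_words_necklaces[OF assms]] by simp
  also have "\<dots> = (\<Sum>ms | list_all2 (dvd) ms ns. card (lyndon_words q ms))"
    using finite_divisor_vectors[OF assms] by (intro card_SigmaI) (auto simp: finite_lyndon_words)
  finally show ?thesis .
qed

theorem theorem2:
  fixes q :: nat and ns :: "nat list"
  assumes "q \<ge> 1" and "ns \<noteq> []" and "\<forall>n\<in>set ns. n > 0"
  shows "int (card (lyndon_words q ns)) = moebius_sum ns (\<lambda>fs. int (card (necklaces q fs)))"
proof -
  have "int (card (necklaces q ms)) = (\<Sum>ls | list_all2 (dvd) ls ms. int (card (lyndon_words q ls)))"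
    if "list_all2 (dvd) ms ns" for ms
    using card_necklaces[OF positive_divisor_vector[OF that assms(3)]] by simp
  then show ?thesis
    using moebius_sum_inversion[OF assms(3), of "\<lambda>fs. int (card (necklaces q fs))"] by simp
qed

end
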